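(* Let $2<p<\infty$ and let $T,S\in B(\ell_2)$. Suppose that the map $\Phi:\ell_p^2\to B(\ell_2)$ defined by $\Phi((z_1,z_2)):=z_1T+z_2S$ is a linear isometry, i.e. $\|z_1T+z_2S\|_{\ell_2\to\ell_2}=(|z_1|^p+|z_2|^p)^{1/p}$ for all $z_1,z_2\in\mathbb{C}$. Then $T\in B(\ell_2)\setminus S_\infty$ and $S\in B(\ell_2)\setminus S_\infty$, i.e. neither $T$ nor $S$ is compact.
   Context: All Banach spaces are complex. $\ell_p^2$ is $\mathbb{C}^2$ with the norm $\|(z_1,z_2)\|_p=(|z_1|^p+|z_2|^p)^{1/p}$. $\ell_2$ is the complex Hilbert space of square-summable sequences, $B(\ell_2)$ is the space of bounded linear operators on $\ell_2$ with the operator norm $\|\cdot\|_{\ell_2\to\ell_2}$, and $S_\infty\subseteq B(\ell_2)$ is the space of all compact operators on $\ell_2$. *)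

theory Defs
  imports "HOL-Analysis.Analysis"
begin

typedef ell2 = "{x :: nat \<Rightarrow> complex. summable (\<lambda>n. (cmod (x n))\<^sup>2)}"
  morphisms ell2_nth Abs_ell2
  by (rule exI[of _ "\<lambda>_. 0"]) simp

setup_lifting type_definition_ell2

lemma summable_ell2: "summable (\<lambda>n. (cmod (ell2_nth x n))\<^sup>2)"
  using ell2_nth by blast

lemma summable_add_sq:
  fixes x y :: "nat \<Rightarrow> complex"
  assumes "summable (\<lambda>n. (cmod (x n))\<^sup>2)" "summable (\<lambda>n. (cmod (y n))\<^sup>2)"
  shows "summable (\<lambda>n. (cmod (x n + y n))\<^sup>2)"
proof (rule summable_comparison_test')
  show "summable (\<lambda>n. 2 * (cmod (x n))\<^sup>2 + 2 * (cmod (y n))\<^sup>2)"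
    by (intro summable_add summable_mult assms)
  show "norm ((cmod (x n + y n))\<^sup>2) \<le> 2 * (cmod (x n))\<^sup>2 + 2 * (cmod (y n))\<^sup>2" for n
  proof -
    have "(cmod (x n + y n))\<^sup>2 \<le> (cmod (x n) + cmod (y n))\<^sup>2"
      by (intro power_mono norm_triangle_ineq) simp
    also have "\<dots> \<le> 2 * (cmod (x n))\<^sup>2 + 2 * (cmod (y n))\<^sup>2"
      using zero_le_power2[of "cmod (x n) - cmod (y n)"]
      by (simp add: power2_eq_square algebra_simps)
    finally show ?thesis by simp
  qed
qed

lemma summable_scale_sq:
  fixes x :: "nat \<Rightarrow> complex"
  assumes "summable (\<lambda>n. (cmod (x n))\<^sup>2)"
  shows "summable (\<lambda>n. (cmod (c * x n))\<^sup>2)"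
  using assms by (simp add: norm_mult power_mult_distrib summable_mult)

lemma summable_ell2_inner: "summable (\<lambda>n. ell2_nth x n \<bullet> ell2_nth y n)"
proof (rule summable_comparison_test')
  show "summable (\<lambda>n. (cmod (ell2_nth x n))\<^sup>2 + (cmod (ell2_nth y n))\<^sup>2)"
    by (intro summable_add summable_ell2)
  show "norm (ell2_nth x n \<bullet> ell2_nth y n)
      \<le> (cmod (ell2_nth x n))\<^sup>2 + (cmod (ell2_nth y n))\<^sup>2" for n
  proof -
    have "\<bar>ell2_nth x n \<bullet> ell2_nth y n\<bar> \<le> cmod (ell2_nth x n) * cmod (ell2_nth y n)"
      by (rule Cauchy_Schwarz_ineq2)
    also have "\<dots> \<le> (cmod (ell2_nth x n))\<^sup>2 + (cmod (ell2_nth y n))\<^sup>2"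
      using sum_squares_bound[of "cmod (ell2_nth x n)" "cmod (ell2_nth y n)"]
        mult_nonneg_nonneg[OF norm_ge_zero[of "ell2_nth x n"] norm_ge_zero[of "ell2_nth y n"]]
      by linarith
    finally show ?thesis by simp
  qed
qed

lift_definition scaleC :: "complex \<Rightarrow> ell2 \<Rightarrow> ell2"  (infixr "*\<^sub>C" 75)
  is "\<lambda>c x n. c * x n"
  by (rule summable_scale_sq)

text \<open>
  The type-class inner product is the real part of the usual complex one; the norm it induces
  is the usual norm of \<open>\<ell>\<^sub>2\<close>.
\<close>

instantiation ell2 :: real_inner
begin

lift_definition zero_ell2 :: ell2 is "\<lambda>_. 0" by simp
lift_definition plus_ell2 :: "ell2 \<Rightarrow> ell2 \<Rightarrow> ell2" is "\<lambda>x y n. x n + y n"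
  by (rule summable_add_sq)
lift_definition uminus_ell2 :: "ell2 \<Rightarrow> ell2" is "\<lambda>x n. - x n" by simp
lift_definition minus_ell2 :: "ell2 \<Rightarrow> ell2 \<Rightarrow> ell2" is "\<lambda>x y n. x n - y n"
  using summable_add_sq[where y = "\<lambda>n. - y n" for y] by simp
lift_definition scaleR_ell2 :: "real \<Rightarrow> ell2 \<Rightarrow> ell2" is "\<lambda>r x n. r *\<^sub>R x n"
  by (simp add: power_mult_distrib summable_mult)

definition norm_ell2 :: "ell2 \<Rightarrow> real"
  where "norm x = sqrt (\<Sum>n. (cmod (ell2_nth x n))\<^sup>2)"
definition inner_ell2 :: "ell2 \<Rightarrow> ell2 \<Rightarrow> real"
  where "x \<bullet> y = (\<Sum>n. ell2_nth x n \<bullet> ell2_nth y n)"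
definition dist_ell2 :: "ell2 \<Rightarrow> ell2 \<Rightarrow> real"
  where "dist x y = norm (x - y)" for x y :: ell2
definition sgn_ell2 :: "ell2 \<Rightarrow> ell2"
  where "sgn x = inverse (norm x) *\<^sub>R x" for x :: ell2
definition uniformity_ell2 :: "(ell2 \<times> ell2) filter"
  where "uniformity = (INF e\<in>{0<..}. principal {(x :: ell2, y). dist x y < e})"
definition open_ell2 :: "ell2 set \<Rightarrow> bool"
  where "open U \<longleftrightarrow> (\<forall>x\<in>U. \<forall>\<^sub>F (x', y) in uniformity. x' = x \<longrightarrow> y \<in> U)" for U :: "ell2 set"

instance
proof
  fix x y z :: ell2 and r s :: real
  show "x + y + z = x + (y + z)" "x + y = y + x" "0 + x = x" "- x + x = 0" "x - y = x + - y"
    by (transfer; simp add: fun_eq_iff)+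
  show "r *\<^sub>R (x + y) = r *\<^sub>R x + r *\<^sub>R y" "(r + s) *\<^sub>R x = r *\<^sub>R x + s *\<^sub>R x"
    "r *\<^sub>R s *\<^sub>R x = (r * s) *\<^sub>R x" "1 *\<^sub>R x = x"
    by (transfer; simp add: fun_eq_iff algebra_simps)+
  show "x \<bullet> y = y \<bullet> x"
    by (simp add: inner_ell2_def inner_commute)
  show "(x + y) \<bullet> z = x \<bullet> z + y \<bullet> z"
    by (simp add: inner_ell2_def plus_ell2.rep_eq inner_add_left suminf_add summable_ell2_inner)
  show "(r *\<^sub>R x) \<bullet> y = r * (x \<bullet> y)"
    by (simp add: inner_ell2_def scaleR_ell2.rep_eq suminf_mult summable_ell2_inner)
  show "0 \<le> x \<bullet> x"
    by (simp add: inner_ell2_def suminf_nonneg summable_ell2_inner)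
  show "(x \<bullet> x = 0) = (x = 0)"
    using suminf_eq_zero_iff[OF summable_ell2_inner[of x x]]
    by (auto simp: inner_ell2_def zero_ell2.rep_eq fun_eq_iff simp flip: ell2_nth_inject)
  show "norm x = sqrt (x \<bullet> x)"
    by (simp add: norm_ell2_def inner_ell2_def power2_norm_eq_inner)
qed (simp_all only: dist_ell2_def sgn_ell2_def uniformity_ell2_def open_ell2_def)

end

text \<open>
  \<open>bounded_linear\<close> is linearity over the reals only, so complex homogeneity is required separately;
  the operator norm is the library's \<open>onorm\<close>.
\<close>

definition bounded_ops :: "(ell2 \<Rightarrow> ell2) set"
  where "bounded_ops = {T. bounded_linear T \<and> (\<forall>c x. T (c *\<^sub>C x) = c *\<^sub>C T x)}"

definition compact_ops :: "(ell2 \<Rightarrow> ell2) set"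
  where "compact_ops = {T \<in> bounded_ops. compact (closure (T ` cball 0 1))}"

definition lp2_norm :: "real \<Rightarrow> complex \<times> complex \<Rightarrow> real"
  where "lp2_norm p z = (cmod (fst z) powr p + cmod (snd z) powr p) powr (1 / p)"

end

theory Submission
  imports Defs
begin

text \<open>
  Only real scalars are needed. Let \<open>T\<close> be compact, \<open>\<parallel>T + z S\<parallel>\<^sup>2 \<le> 1 + \<bar>z\<bar>\<^sup>p\<close>, and let \<open>E\<close> be the
  subspace on which \<open>T\<close> attains its norm. Since \<open>p > 2\<close>, comparing terms of second order in \<open>z\<close>
  shows that \<open>S\<close> vanishes on \<open>E\<close> and that the range of \<open>S\<close> is orthogonal to \<open>T E\<close>, so \<open>T + z S\<close>
  is the orthogonal sum of the isometry \<open>T\<close> on \<open>E\<close> and of \<open>T + z S\<close> on the complement of \<open>E\<close>.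
  By compactness \<open>T\<close> has norm less than \<open>1\<close> on that complement, hence \<open>\<parallel>T + z S\<parallel> \<le> 1\<close>
  for small \<open>z\<close>, whereas the isometry hypothesis makes this norm greater than \<open>1\<close> for \<open>z \<noteq> 0\<close>.
\<close>

section \<open>Completeness of the sequence space\<close>

lemma sum_le_norm_ell2_sq: "(\<Sum>k<K. (cmod (ell2_nth x k))\<^sup>2) \<le> (norm x)\<^sup>2"
proof -
  have "(\<Sum>k<K. (cmod (ell2_nth x k))\<^sup>2) \<le> (\<Sum>k. (cmod (ell2_nth x k))\<^sup>2)"
    by (rule sum_le_suminf[OF summable_ell2]) auto
  then show ?thesis
    by (simp add: norm_ell2_def suminf_nonneg summable_ell2)
qed

lemma cmod_ell2_nth_le_norm: "cmod (ell2_nth x k) \<le> norm x"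
proof (rule power2_le_imp_le)
  have "(cmod (ell2_nth x k))\<^sup>2 \<le> (\<Sum>j<Suc k. (cmod (ell2_nth x j))\<^sup>2)"
    by (rule member_le_sum) auto
  then show "(cmod (ell2_nth x k))\<^sup>2 \<le> (norm x)\<^sup>2"
    using sum_le_norm_ell2_sq[of x "Suc k"] by linarith
qed simp

lemma norm_ell2_le:
  assumes "0 \<le> e" "\<And>K. (\<Sum>k<K. (cmod (ell2_nth x k))\<^sup>2) \<le> e\<^sup>2"
  shows "norm x \<le> e"
  unfolding norm_ell2_def
  using suminf_le_const[OF summable_ell2 assms(2)] assms(1)
  by (metis real_sqrt_le_mono real_sqrt_abs abs_of_nonneg)

text \<open>This provides the limits of the Cauchy sequences that arise from nearly norm-preserved
  vectors below.\<close>

instance ell2 :: complete_space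
proof
  fix X :: "nat \<Rightarrow> ell2"
  assume X: "Cauchy X"
  have "Cauchy (\<lambda>n. ell2_nth (X n) k)" for k
  proof (rule metric_CauchyI)
    fix e :: real
    assume "0 < e"
    then obtain M where M: "\<And>m n. M \<le> m \<Longrightarrow> M \<le> n \<Longrightarrow> dist (X m) (X n) < e"
      using X by (meson metric_CauchyD)
    have "dist (ell2_nth (X m) k) (ell2_nth (X n) k) < e" if "M \<le> m" "M \<le> n" for m n
      using cmod_ell2_nth_le_norm[of "X m - X n" k] M[OF that]
      by (simp add: dist_norm minus_ell2.rep_eq)
    then show "\<exists>M. \<forall>m\<ge>M. \<forall>n\<ge>M. dist (ell2_nth (X m) k) (ell2_nth (X n) k) < e" by blast
  qed
  then have "\<exists>l. (\<lambda>n. ell2_nth (X n) k) \<longlonglongrightarrow> l" for k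
    by (simp add: Cauchy_convergent_iff convergent_def)
  then obtain l where l: "\<And>k. (\<lambda>n. ell2_nth (X n) k) \<longlonglongrightarrow> l k" by metis
  \<comment> \<open>In a finite sum the limit in \<open>m\<close> can be taken coordinatewise.
    Uniformity in \<open>K\<close> then gives both square-summability of \<open>l\<close> and
    convergence in norm.\<close>
  have tail: "\<exists>M. \<forall>n\<ge>M. \<forall>K. (\<Sum>k<K. (cmod (ell2_nth (X n) k - l k))\<^sup>2) \<le> e\<^sup>2"
    if e: "0 < e" for e
  proof -
    obtain M where M: "\<And>m n. M \<le> m \<Longrightarrow> M \<le> n \<Longrightarrow> dist (X m) (X n) < e"
      using X e by (meson metric_CauchyD)
    have "(\<Sum>k<K. (cmod (ell2_nth (X n) k - l k))\<^sup>2) \<le> e\<^sup>2" if n: "M \<le> n" for n K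
    proof (rule LIMSEQ_le_const2)
      show "(\<lambda>m. \<Sum>k<K. (cmod (ell2_nth (X n) k - ell2_nth (X m) k))\<^sup>2)
          \<longlonglongrightarrow> (\<Sum>k<K. (cmod (ell2_nth (X n) k - l k))\<^sup>2)"
        by (intro tendsto_intros l)
      have "(\<Sum>k<K. (cmod (ell2_nth (X n) k - ell2_nth (X m) k))\<^sup>2) \<le> e\<^sup>2" if "M \<le> m" for m
      proof -
        have "(norm (X n - X m))\<^sup>2 \<le> e\<^sup>2"
          using M[OF n that] by (intro power_mono) (auto simp: dist_norm)
        then show ?thesis
          using sum_le_norm_ell2_sq[of "X n - X m" K] by (simp add: minus_ell2.rep_eq)
      qed
      then show "\<exists>N. \<forall>m\<ge>N. (\<Sum>k<K. (cmod (ell2_nth (X n) k - ell2_nth (X m) k))\<^sup>2) \<le> e\<^sup>2"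
        by blast
    qed
    then show ?thesis by blast
  qed
  obtain M where M: "\<And>K. (\<Sum>k<K. (cmod (ell2_nth (X M) k - l k))\<^sup>2) \<le> 1\<^sup>2"
    using tail[of 1] by auto
  have "summable (\<lambda>k. (cmod (ell2_nth (X M) k - l k))\<^sup>2)"
    by (rule summableI_nonneg_bounded[OF _ M]) simp
  then have "summable (\<lambda>k. (cmod (l k - ell2_nth (X M) k))\<^sup>2)"
    by (simp add: norm_minus_commute)
  \<comment> \<open>Write \<open>l\<close> as \<open>(l - X M) + X M\<close>, both terms being
    square-summable.\<close>
  from summable_add_sq[OF this summable_ell2[of "X M"]]
  have "summable (\<lambda>k. (cmod (l k))\<^sup>2)" by simp
  then have L: "ell2_nth (Abs_ell2 l) = l"
    by (simp add: Abs_ell2_inverse)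
  have "X \<longlonglongrightarrow> Abs_ell2 l"
  proof (rule metric_LIMSEQ_I)
    fix r :: real
    assume r: "0 < r"
    then obtain M where
      M: "\<And>n K. M \<le> n \<Longrightarrow> (\<Sum>k<K. (cmod (ell2_nth (X n) k - l k))\<^sup>2) \<le> (r/2)\<^sup>2"
      using tail[of "r/2"] by auto
    have "norm (X n - Abs_ell2 l) \<le> r/2" if "M \<le> n" for n
      using r M[OF that] by (intro norm_ell2_le) (auto simp: minus_ell2.rep_eq L)
    then show "\<exists>no. \<forall>n\<ge>no. dist (X n) (Abs_ell2 l) < r"
      using r by (intro exI[of _ M]) (force simp: dist_norm)
  qed
  then show "convergent X" by (rule convergentI)
qed

section \<open>Compact contractions\<close>

text \<open>Near 0 a linear term dominates a quadratic one, and \<open>t\<close> may take either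
  sign. Every first-variation argument below ends with this lemma.\<close>

lemma linear_le_square_imp_zero:
  fixes a M :: real
  assumes "\<And>t. t * a \<le> t\<^sup>2 * M"
  shows "a = 0"
proof -
  have "a * a \<le> 0"
  proof (rule field_le_epsilon)
    fix e :: real
    assume e: "0 < e"
    \<comment> \<open>Testing \<open>t = c * a\<close> and cancelling one factor \<open>c\<close>
      leaves an error \<open>c * (a\<^sup>2 * M)\<close>, at most \<open>e\<close> for this
      \<open>c\<close>; the summand 1 keeps the denominator positive.\<close>
    define c where "c = e / (\<bar>a\<^sup>2 * M\<bar> + 1)"
    have c: "0 < c" using e by (simp add: c_def)
    have "(c * a) * a \<le> (c * a)\<^sup>2 * M" by (rule assms)
    then have "c * (a * a) \<le> c * (c * (a\<^sup>2 * M))"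
      by (simp add: power2_eq_square mult_ac)
    then have "a * a \<le> c * (a\<^sup>2 * M)"
      using c mult_le_cancel_left_pos by blast
    also have "\<dots> \<le> c * (\<bar>a\<^sup>2 * M\<bar> + 1)"
      using c by (intro mult_left_mono) linarith+
    also have "\<dots> = e" by (simp add: c_def add_nonneg_eq_0_iff)
    finally show "a * a \<le> 0 + e" by simp
  qed
  then show ?thesis by (auto simp: mult_le_0_iff)
qed

lemma norm_add_sq:
  fixes x y :: "'a::real_inner"
  shows "(norm (x + y))\<^sup>2 = (norm x)\<^sup>2 + 2 * (x \<bullet> y) + (norm y)\<^sup>2"
  by (simp add: power2_norm_eq_inner inner_add_left inner_add_right inner_commute)

locale contraction =
  fixes T :: "'a::{real_inner,complete_space} \<Rightarrow> 'a"
  assumes bounded_linear: "bounded_linear T"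
    and contraction: "\<And>x. norm (T x) \<le> norm x"
begin

interpretation T: bounded_linear T by (rule bounded_linear)

text \<open>This is the kernel of I - T*T, written without adjoints. The bilinear form makes it
  visibly a subspace; for a contraction it consists of the vectors whose norm \<open>T\<close>
  preserves, by \<open>norm_norming\<close> and \<open>normingI\<close>.\<close>

definition norming :: "'a set"
  where "norming = {x. \<forall>y. T x \<bullet> T y = x \<bullet> y}"

lemma norming_add: "x \<in> norming \<Longrightarrow> y \<in> norming \<Longrightarrow> x + y \<in> norming"
  by (simp add: norming_def T.add inner_add_left)

lemma norming_scaleR: "x \<in> norming \<Longrightarrow> c *\<^sub>R x \<in> norming"
  by (simp add: norming_def T.scaleR)

lemma norm_norming: "x \<in> norming \<Longrightarrow> norm (T x) = norm x"
  by (simp add: norming_def norm_eq_sqrt_inner)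

lemma norming_inner_eq: "x \<in> norming \<Longrightarrow> T x \<bullet> T y = x \<bullet> y"
  by (simp add: norming_def)

lemma contraction_sq: "(norm (T x))\<^sup>2 \<le> (norm x)\<^sup>2"
  by (intro power_mono contraction) simp

text \<open>The defect \<open>(norm (x + t *\<^sub>R y))\<^sup>2 - (norm (T (x + t *\<^sub>R
  y)))\<^sup>2\<close> is nonnegative and vanishes at \<open>t = 0\<close>, so its linear
  coefficient in \<open>t\<close> is zero.\<close>

lemma normingI:
  assumes "norm (T x) = norm x"
  shows "x \<in> norming"
proof -
  have "T x \<bullet> T y = x \<bullet> y" for y
  proof -
    have "t * (2 * (T x \<bullet> T y - x \<bullet> y)) \<le> t\<^sup>2 * (norm y)\<^sup>2" for t
    proof -
      have "(norm (T x + t *\<^sub>R T y))\<^sup>2 \<le> (norm (x + t *\<^sub>R y))\<^sup>2"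
        using contraction_sq[of "x + t *\<^sub>R y"] by (simp add: T.add T.scaleR)
      moreover have "0 \<le> t\<^sup>2 * (norm (T y))\<^sup>2" by simp
      ultimately show ?thesis
        using assms unfolding norm_add_sq by (simp add: power_mult_distrib algebra_simps; linarith)
    qed
    from linear_le_square_imp_zero[OF this] show ?thesis by simp
  qed
  then show ?thesis by (simp add: norming_def)
qed

text \<open>Subtract the parallelogram laws for \<open>x, y\<close> and \<open>T x, T y\<close> and
  use contractivity at \<open>x + y\<close>. When the defects are small, closeness of the images
  forces closeness of the vectors.\<close>

lemma dist_sq_le:
  "(norm (x - y))\<^sup>2 \<le> (norm (T x - T y))\<^sup>2
     + 2 * ((norm x)\<^sup>2 - (norm (T x))\<^sup>2) + 2 * ((norm y)\<^sup>2 - (norm (T y))\<^sup>2)"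
  using contraction_sq[of "x + y"] norm_add_sq[of x y] norm_add_sq[of x "- y"]
    norm_add_sq[of "T x" "T y"] norm_add_sq[of "T x" "- T y"]
  by (simp add: T.add)

end

locale compact_contraction = contraction +
  assumes compact: "compact (closure (T ` cball 0 1))"
begin

interpretation T: bounded_linear T by (rule bounded_linear)

lemma convergent_subseq_image:
  assumes "\<And>n. norm (x n) \<le> R"
  obtains r where "strict_mono (r :: nat \<Rightarrow> nat)" "convergent (\<lambda>n. T (x (r n)))"
proof -
  define d where "d = \<bar>R\<bar> + 1"
  have d: "d > 0" "\<And>n. norm (x n) \<le> d"
    using assms by (auto simp: d_def intro: order_trans[OF assms])
  have "T ((1/d) *\<^sub>R x n) \<in> closure (T ` cball 0 1)" for n
    using d by (intro subsetD[OF closure_subset] imageI) (simp add: divide_simps)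
  then obtain l r where r: "strict_mono (r :: nat \<Rightarrow> nat)"
    and l: "((\<lambda>n. T ((1/d) *\<^sub>R x n)) \<circ> r) \<longlonglongrightarrow> l"
    using compact unfolding compact_def by metis
  have "(\<lambda>n. d *\<^sub>R T ((1/d) *\<^sub>R x (r n))) \<longlonglongrightarrow> d *\<^sub>R l"
    using l by (intro tendsto_intros) (simp add: o_def)
  then have "(\<lambda>n. T (x (r n))) \<longlonglongrightarrow> d *\<^sub>R l"
    using d by (simp add: T.scaleR)
  with r show ?thesis using that convergentI by blast
qed

text \<open>Compactness makes the images converge along a subsequence, \<open>dist_sq_le\<close>
  turns this into a Cauchy property of the vectors, and by continuity the limit has zero
  defect.\<close>

lemma convergent_subseq_norming:
  assumes bound: "\<And>n. norm (x n) \<le> R"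
    and lim: "(\<lambda>n. (norm (x n))\<^sup>2 - (norm (T (x n)))\<^sup>2) \<longlonglongrightarrow> 0"
  obtains r l where "strict_mono (r :: nat \<Rightarrow> nat)" "(x \<circ> r) \<longlonglongrightarrow> l" "l \<in> norming"
proof -
  obtain r where r: "strict_mono (r :: nat \<Rightarrow> nat)" and conv: "convergent (\<lambda>n. T (x (r n)))"
    using convergent_subseq_image[of x, OF bound] by blast
  define \<delta> where "\<delta> = (\<lambda>n. (norm (x (r n)))\<^sup>2 - (norm (T (x (r n))))\<^sup>2)"
  have \<delta>: "\<delta> \<longlonglongrightarrow> 0"
    using LIMSEQ_subseq_LIMSEQ[OF lim r] by (simp add: \<delta>_def o_def)
  have "Cauchy (x \<circ> r)"
  proof (rule metric_CauchyI)
    fix e :: real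
    assume e: "0 < e"
    obtain M where M: "\<And>m n. M \<le> m \<Longrightarrow> M \<le> n \<Longrightarrow> dist (T (x (r m))) (T (x (r n))) < e/2"
      using convergent_Cauchy[OF conv] e by (metis half_gt_zero metric_CauchyD)
    \<comment> \<open>In \<open>dist_sq_le\<close> the image term gives e^2/4 and the two doubled
      defects less than e^2/4 each, so the total stays below e^2.\<close>
    have "eventually (\<lambda>n. \<delta> n < e\<^sup>2 / 8) sequentially"
      using order_tendstoD(2)[OF \<delta>, of "e\<^sup>2 / 8"] e by simp
    then obtain N where N: "\<And>n. N \<le> n \<Longrightarrow> \<delta> n < e\<^sup>2 / 8"
      by (auto simp: eventually_sequentially)
    have "dist (x (r m)) (x (r n)) < e" if m: "max M N \<le> m" and n: "max M N \<le> n" for m n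
    proof -
      have "(norm (T (x (r m)) - T (x (r n))))\<^sup>2 \<le> (e/2)\<^sup>2"
        using M[of m n] m n by (intro power_mono) (auto simp: dist_norm)
      then have "(norm (T (x (r m)) - T (x (r n))))\<^sup>2 \<le> e\<^sup>2 / 4"
        by (simp add: power_divide)
      moreover have "\<delta> m < e\<^sup>2 / 8" "\<delta> n < e\<^sup>2 / 8" using N m n by auto
      ultimately have "(norm (x (r m) - x (r n)))\<^sup>2 < e\<^sup>2"
        using dist_sq_le[of "x (r m)" "x (r n)"] zero_less_power[OF e, of 2]
        unfolding \<delta>_def by argo
      then show ?thesis using e by (simp add: dist_norm power2_less_imp_less)
    qed
    then show "\<exists>M. \<forall>m\<ge>M. \<forall>n\<ge>M. dist ((x \<circ> r) m) ((x \<circ> r) n) < e" by (metis comp_apply)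
  qed
  then obtain l where l: "(x \<circ> r) \<longlonglongrightarrow> l"
    by (auto simp: Cauchy_convergent_iff convergent_def)
  then have xr: "(\<lambda>n. x (r n)) \<longlonglongrightarrow> l" by (simp add: o_def)
  have "\<delta> \<longlonglongrightarrow> (norm l)\<^sup>2 - (norm (T l))\<^sup>2"
    unfolding \<delta>_def by (intro tendsto_intros T.tendsto xr)
  with \<delta> have "(norm l)\<^sup>2 - (norm (T l))\<^sup>2 = 0" by (rule LIMSEQ_unique[symmetric])
  then have "l \<in> norming" by (intro normingI) simp
  with r l show ?thesis using that by blast
qed

lemma compact_norming: "compact (norming \<inter> cball 0 R)"
  unfolding compact_def
proof (intro allI impI)
  fix x :: "nat \<Rightarrow> 'a"
  assume x: "\<forall>n. x n \<in> norming \<inter> cball 0 R"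
  then have bound: "\<And>n. norm (x n) \<le> R" by simp
  have "(\<lambda>n. (norm (x n))\<^sup>2 - (norm (T (x n)))\<^sup>2) \<longlonglongrightarrow> 0"
    using x by (simp add: norm_norming)
  then obtain r l where r: "strict_mono (r :: nat \<Rightarrow> nat)" and l: "(x \<circ> r) \<longlonglongrightarrow> l" "l \<in> norming"
    using convergent_subseq_norming[of x, OF bound] by blast
  have "norm l \<le> R"
    using tendsto_norm[OF l(1)] by (rule LIMSEQ_le_const2) (use bound in auto)
  with r l show "\<exists>l\<in>norming \<inter> cball 0 R. \<exists>r. strict_mono r \<and> (x \<circ> r) \<longlonglongrightarrow> l" by auto
qed

text \<open>Take \<open>e\<close> to be a nearest point of \<open>norming\<close> to
  \<open>x\<close>, which exists by compactness of balls in \<open>norming\<close>; the first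
  variation of the distance gives orthogonality.\<close>

lemma orthogonal_decomposition:
  obtains e where "e \<in> norming" "\<And>y. y \<in> norming \<Longrightarrow> y \<bullet> (x - e) = 0"
proof -
  \<comment> \<open>A vector of norm above \<open>2 * norm x\<close> is farther from
    \<open>x\<close> than 0 is, so minimising over this ball minimises over all of
    \<open>norming\<close>.\<close>
  let ?K = "norming \<inter> cball 0 (2 * norm x)"
  have 0: "0 \<in> ?K" by (simp add: norming_def T.zero)
  obtain e where e: "e \<in> ?K" and le: "\<And>y. y \<in> ?K \<Longrightarrow> norm (x - e) \<le> norm (x - y)"
  proof -
    have "continuous_on ?K (\<lambda>y. norm (x - y))" by (intro continuous_intros)
    moreover have "?K \<noteq> {}" using 0 by blast
    ultimately show ?thesis
      using continuous_attains_inf[OF compact_norming] that by blast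
  qed
  have min: "norm (x - e) \<le> norm (x - y)" if y: "y \<in> norming" for y
  proof (cases "norm y \<le> 2 * norm x")
    case True
    with y show ?thesis by (intro le) simp
  next
    case False
    have "norm y \<le> norm x + norm (x - y)"
      using norm_triangle_ineq4[of x "x - y"] by simp
    with False le[OF 0] show ?thesis by simp
  qed
  have "y \<bullet> (x - e) = 0" if y: "y \<in> norming" for y
  proof -
    have "t * (2 * (y \<bullet> (x - e))) \<le> t\<^sup>2 * (norm y)\<^sup>2" for t
    proof -
      have "(norm (x - e))\<^sup>2 \<le> (norm (x - (e + t *\<^sub>R y)))\<^sup>2"
        using e y by (intro power_mono min norming_add norming_scaleR) auto
      also have "x - (e + t *\<^sub>R y) = (x - e) + (- t) *\<^sub>R y" by simp
      finally show ?thesis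
        unfolding norm_add_sq
        by (simp add: power_mult_distrib inner_commute)
    qed
    from linear_le_square_imp_zero[OF this] show ?thesis by simp
  qed
  with e that show ?thesis by blast
qed

end

section \<open>Perturbations of higher than second order\<close>

lemma powr_tendsto_0:
  fixes p :: real
  assumes "2 < p"
  shows "((\<lambda>z. z powr (p - 2)) \<longlongrightarrow> 0) (at_right 0)"
proof -
  have "((\<lambda>z::real. z powr (p - 2)) \<longlongrightarrow> 0 powr (p - 2)) (at_right 0)"
    by (rule tendsto_powr') (use assms in \<open>auto simp: eventually_at_filter\<close>)
  then show ?thesis by simp
qed

text \<open>Since \<open>p > 2\<close>, the excess \<open>\<bar>z\<bar> powr p\<close> in
  \<open>flat\<close> is o(z^2), so it disappears when terms up to second order in \<open>z\<close>
  are compared.\<close>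

locale flat_perturbation = compact_contraction +
  fixes S :: "'a \<Rightarrow> 'a" and p :: real
  assumes bounded_linear_S: "bounded_linear S"
    and p: "2 < p"
    and flat: "\<And>z x. (norm (T x + z *\<^sub>R S x))\<^sup>2 \<le> (1 + \<bar>z\<bar> powr p) * (norm x)\<^sup>2"
begin

interpretation T: bounded_linear T by (rule bounded_linear)
interpretation S: bounded_linear S by (rule bounded_linear_S)

text \<open>Adding the bounds for \<open>z\<close> and \<open>- z\<close> cancels the cross term
  \<open>T x \<bullet> S x\<close>. As \<open>T\<close> preserves the norm of \<open>x\<close>,
  dividing by z^2 and letting \<open>z\<close> tend to 0 leaves nothing for
  \<open>S x\<close>.\<close>

lemma perturbation_norming_zero:
  assumes x: "x \<in> norming"
  shows "S x = 0"
proof -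
  have "(norm (S x))\<^sup>2 \<le> z powr (p - 2) * (norm x)\<^sup>2" if z: "0 < z" for z
  proof -
    have "z\<^sup>2 * (norm (S x))\<^sup>2 \<le> z powr p * (norm x)\<^sup>2"
      using flat[of x z] flat[of x "- z"] norm_add_sq[of "T x" "z *\<^sub>R S x"]
        norm_add_sq[of "T x" "(- z) *\<^sub>R S x"] norm_norming[OF x] z
      by (simp add: power_mult_distrib algebra_simps)
    moreover have "z powr p = z\<^sup>2 * z powr (p - 2)"
      using z by (simp add: powr_diff)
    ultimately show ?thesis using z by (simp add: mult.assoc)
  qed
  then have "eventually (\<lambda>z. (norm (S x))\<^sup>2 \<le> z powr (p - 2) * (norm x)\<^sup>2) (at_right 0)"
    by (simp add: eventually_at_filter)
  moreover have "((\<lambda>z. z powr (p - 2) * (norm x)\<^sup>2) \<longlongrightarrow> 0 * (norm x)\<^sup>2) (at_right 0)"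
    by (intro tendsto_intros powr_tendsto_0 p)
  ultimately have "(norm (S x))\<^sup>2 \<le> 0 * (norm x)\<^sup>2"
    by (intro tendsto_lowerbound[of _ _ "at_right 0"]) auto
  then show ?thesis by simp
qed

lemma perturbation_range_orthogonal:
  assumes x: "x \<in> norming"
  shows "T x \<bullet> S y = 0"
proof -
  have "t * (2 * (T x \<bullet> S y)) \<le> t\<^sup>2 * (norm y)\<^sup>2" for t
  proof -
    \<comment> \<open>Test the bound at \<open>x + (t z) y\<close>: the term of order \<open>z\<^sup>2\<close> then isolates the inner product.\<close>
    have "t * (2 * (T x \<bullet> S y))
        \<le> z powr (p - 2) * (norm (x + (t * z) *\<^sub>R y))\<^sup>2 + t\<^sup>2 * (norm y)\<^sup>2" if z: "0 < z" for z
    proof -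
      have "T (x + (t * z) *\<^sub>R y) + z *\<^sub>R S (x + (t * z) *\<^sub>R y)
          = T x + (t * z) *\<^sub>R (T y + z *\<^sub>R S y)"
        by (simp add: T.add T.scaleR S.add S.scaleR perturbation_norming_zero[OF x] algebra_simps)
      with flat[of "x + (t * z) *\<^sub>R y" z] z
      have "(norm (T x + (t * z) *\<^sub>R (T y + z *\<^sub>R S y)))\<^sup>2
          \<le> (1 + z powr p) * (norm (x + (t * z) *\<^sub>R y))\<^sup>2" by simp
      \<comment> \<open>Because \<open>T x \<bullet> T y = x \<bullet> y\<close>, the terms of order
        0 and 1 in \<open>z\<close> match those of \<open>norm_add_sq\<close> on the right. After
        they cancel, z^2 can be divided out.\<close>
      then have "(norm x)\<^sup>2 + 2 * (t * z) * (x \<bullet> y) + 2 * (t * z) * (z * (T x \<bullet> S y))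
            + (norm ((t * z) *\<^sub>R (T y + z *\<^sub>R S y)))\<^sup>2
          \<le> (norm (x + (t * z) *\<^sub>R y))\<^sup>2 + z powr p * (norm (x + (t * z) *\<^sub>R y))\<^sup>2"
        unfolding norm_add_sq[of "T x"]
        by (simp add: norm_norming[OF x] norming_inner_eq[OF x] inner_add_right algebra_simps)
      moreover have "(norm (x + (t * z) *\<^sub>R y))\<^sup>2
          = (norm x)\<^sup>2 + 2 * (t * z) * (x \<bullet> y) + z\<^sup>2 * (t\<^sup>2 * (norm y)\<^sup>2)"
        unfolding norm_add_sq by (simp add: power_mult_distrib)
      moreover have "z powr p * (norm (x + (t * z) *\<^sub>R y))\<^sup>2
          = z\<^sup>2 * (z powr (p - 2) * (norm (x + (t * z) *\<^sub>R y))\<^sup>2)"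
        using z by (simp add: powr_diff)
      moreover have "2 * (t * z) * (z * (T x \<bullet> S y)) = z\<^sup>2 * (t * (2 * (T x \<bullet> S y)))"
        by (simp add: power2_eq_square)
      moreover have "0 \<le> (norm ((t * z) *\<^sub>R (T y + z *\<^sub>R S y)))\<^sup>2" by simp
      ultimately have "z\<^sup>2 * (t * (2 * (T x \<bullet> S y)))
          \<le> z\<^sup>2 * (z powr (p - 2) * (norm (x + (t * z) *\<^sub>R y))\<^sup>2 + t\<^sup>2 * (norm y)\<^sup>2)"
        unfolding distrib_left by linarith
      then show ?thesis using z by (meson mult_le_cancel_left_pos zero_less_power)
    qed
    then have "eventually (\<lambda>z. t * (2 * (T x \<bullet> S y))
        \<le> z powr (p - 2) * (norm (x + (t * z) *\<^sub>R y))\<^sup>2 + t\<^sup>2 * (norm y)\<^sup>2) (at_right 0)"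
      by (simp add: eventually_at_filter)
    moreover have "((\<lambda>z. z powr (p - 2) * (norm (x + (t * z) *\<^sub>R y))\<^sup>2 + t\<^sup>2 * (norm y)\<^sup>2)
        \<longlongrightarrow> 0 * (norm (x + (t * 0) *\<^sub>R y))\<^sup>2 + t\<^sup>2 * (norm y)\<^sup>2) (at_right 0)"
      by (intro tendsto_intros powr_tendsto_0 p)
    ultimately have "t * (2 * (T x \<bullet> S y))
        \<le> 0 * (norm (x + (t * 0) *\<^sub>R y))\<^sup>2 + t\<^sup>2 * (norm y)\<^sup>2"
      by (intro tendsto_lowerbound[of _ _ "at_right 0"]) auto
    then show ?thesis by simp
  qed
  from linear_le_square_imp_zero[OF this] show ?thesis by simp
qed

text \<open>Split \<open>x = e + f\<close> with \<open>e\<close> in \<open>norming\<close>. Since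
  \<open>S e = 0\<close> and \<open>T e\<close> is orthogonal to \<open>T f\<close> and
  \<open>S f\<close>, Pythagoras shows that \<open>e\<close> contributes equally to both norms. The
  excess thus comes from \<open>f\<close>, which is then normalised.\<close>

lemma expanding_orthogonal_vector:
  assumes "norm x < norm (T x + z *\<^sub>R S x)"
  obtains f where "norm f = 1" "\<And>y. y \<in> norming \<Longrightarrow> y \<bullet> f = 0" "1 < norm (T f + z *\<^sub>R S f)"
proof -
  obtain e where e: "e \<in> norming" and orth: "\<And>y. y \<in> norming \<Longrightarrow> y \<bullet> (x - e) = 0"
    using orthogonal_decomposition by blast
  define f where "f = x - e"
  have xf: "x = e + f" by (simp add: f_def)
  have eq: "T x + z *\<^sub>R S x = T e + (T f + z *\<^sub>R S f)"
    by (simp add: xf T.add S.add perturbation_norming_zero[OF e])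
  have "e \<bullet> f = 0" using orth e by (simp add: f_def)
  then have "(norm x)\<^sup>2 = (norm e)\<^sup>2 + (norm f)\<^sup>2"
    and "(norm (T x + z *\<^sub>R S x))\<^sup>2 = (norm e)\<^sup>2 + (norm (T f + z *\<^sub>R S f))\<^sup>2"
    unfolding eq unfolding xf norm_add_sq[of e] norm_add_sq[of "T e"]
    by (simp_all add: inner_add_right norming_inner_eq[OF e] norm_norming[OF e]
        perturbation_range_orthogonal[OF e])
  moreover have "(norm x)\<^sup>2 < (norm (T x + z *\<^sub>R S x))\<^sup>2"
    using assms by (intro power_strict_mono) auto
  ultimately have "(norm f)\<^sup>2 < (norm (T f + z *\<^sub>R S f))\<^sup>2" by linarith
  then have lt: "norm f < norm (T f + z *\<^sub>R S f)" by (rule power2_less_imp_less) simp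
  then have nz: "f \<noteq> 0" by (auto simp: T.zero S.zero)
  have "T (sgn f) + z *\<^sub>R S (sgn f) = (1 / norm f) *\<^sub>R (T f + z *\<^sub>R S f)"
    by (simp add: sgn_div_norm T.scaleR S.scaleR scaleR_add_right divide_inverse mult.commute)
  then have "1 < norm (T (sgn f) + z *\<^sub>R S (sgn f))"
    using lt nz by simp
  moreover have "norm (sgn f) = 1" using nz by (simp add: norm_sgn)
  moreover have "y \<bullet> sgn f = 0" if "y \<in> norming" for y
    using orth[OF that] by (simp add: sgn_div_norm f_def)
  ultimately show ?thesis using that by blast
qed

text \<open>Otherwise, as \<open>z\<close> tends to 0, there are unit vectors orthogonal to
  \<open>norming\<close> whose images under \<open>T\<close> have norms tending to 1. A limit point
  would be a unit vector both in \<open>norming\<close> and orthogonal to it.\<close>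

lemma not_always_expanding: "\<exists>z\<noteq>0. \<forall>x. norm (T x + z *\<^sub>R S x) \<le> norm x"
proof (rule ccontr)
  assume "\<not> ?thesis"
  then have ex: "\<exists>x. norm x < norm (T x + z *\<^sub>R S x)" if "z \<noteq> 0" for z
    using that by (meson not_le)
  define z where "z n = inverse (real (Suc n))" for n
  have z: "z n > 0" for n by (simp add: z_def)
  have "\<exists>f. norm f = 1 \<and> (\<forall>y\<in>norming. y \<bullet> f = 0) \<and> 1 < norm (T f + z n *\<^sub>R S f)" for n
    using ex[of "z n"] z[of n] expanding_orthogonal_vector[of _ "z n"] by (metis less_irrefl)
  then obtain f where f: "\<And>n. norm (f n) = 1" "\<And>n y. y \<in> norming \<Longrightarrow> y \<bullet> f n = 0"
    "\<And>n. 1 < norm (T (f n) + z n *\<^sub>R S (f n))" by metis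
  have lower: "1 - z n * onorm S \<le> norm (T (f n))" for n
  proof -
    have "norm (S (f n)) \<le> onorm S"
      using onorm[OF bounded_linear_S, of "f n"] f(1) by simp
    then have "norm (z n *\<^sub>R S (f n)) \<le> z n * onorm S"
      using z[of n] by simp
    with f(3)[of n] norm_triangle_ineq[of "T (f n)" "z n *\<^sub>R S (f n)"] show ?thesis by linarith
  qed
  have "(\<lambda>n. norm (T (f n))) \<longlonglongrightarrow> 1"
  proof (rule tendsto_sandwich)
    show "eventually (\<lambda>n. 1 - z n * onorm S \<le> norm (T (f n))) sequentially"
      using lower by simp
    show "eventually (\<lambda>n. norm (T (f n)) \<le> 1) sequentially"
      using contraction[of "f n" for n] by (simp add: f(1))
    have "(\<lambda>n. 1 - z n * onorm S) \<longlonglongrightarrow> 1 - 0 * onorm S"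
      unfolding z_def by (intro tendsto_intros LIMSEQ_inverse_real_of_nat)
    then show "(\<lambda>n. 1 - z n * onorm S) \<longlonglongrightarrow> 1" by simp
  qed simp
  then have "(\<lambda>n. (norm (f n))\<^sup>2 - (norm (T (f n)))\<^sup>2) \<longlonglongrightarrow> 1\<^sup>2 - 1\<^sup>2"
    unfolding f(1) by (intro tendsto_intros)
  then obtain r l where r: "strict_mono (r :: nat \<Rightarrow> nat)" and l: "(f \<circ> r) \<longlonglongrightarrow> l" "l \<in> norming"
    using convergent_subseq_norming[of f 1] f(1) by auto
  \<comment> \<open>Every term is 0 because \<open>l\<close> lies in \<open>norming\<close>, so the
    limit \<open>l\<close> is orthogonal to itself.\<close>
  have "(\<lambda>n. l \<bullet> (f \<circ> r) n) \<longlonglongrightarrow> l \<bullet> l" by (intro tendsto_intros l(1))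
  then have "l \<bullet> l = 0" using f(2)[OF l(2)] by (simp add: LIMSEQ_const_iff)
  moreover have "(\<lambda>n. norm ((f \<circ> r) n)) \<longlonglongrightarrow> norm l" by (intro tendsto_intros l(1))
  then have "norm l = 1" using f(1) by (simp add: LIMSEQ_const_iff)
  ultimately show False by simp
qed

end

section \<open>From the operator norm identity to non-compactness\<close>

lemma onorm_powr_imp_not_compact:
  fixes T S :: "'a::{real_inner,complete_space} \<Rightarrow> 'a"
  assumes p: "2 < p" and T: "bounded_linear T" and S: "bounded_linear S"
    and on: "\<And>z::real. onorm (\<lambda>x. T x + z *\<^sub>R S x) = (1 + \<bar>z\<bar> powr p) powr (1 / p)"
  shows "\<not> compact (closure (T ` cball 0 1))"
proof
  assume "compact (closure (T ` cball 0 1))"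
  have bl: "bounded_linear (\<lambda>x. T x + z *\<^sub>R S x)" for z
    by (intro bounded_linear_add T bounded_linear_scaleR_right[THEN bounded_linear_compose] S)
  have flat: "(norm (T x + z *\<^sub>R S x))\<^sup>2 \<le> (1 + \<bar>z\<bar> powr p) * (norm x)\<^sup>2" for z x
  proof -
    have "(norm (T x + z *\<^sub>R S x))\<^sup>2 \<le> ((1 + \<bar>z\<bar> powr p) powr (1 / p) * norm x)\<^sup>2"
      using onorm[OF bl[of z], of x] by (intro power_mono) (simp_all add: on)
    also have "\<dots> = (1 + \<bar>z\<bar> powr p) powr (2 / p) * (norm x)\<^sup>2"
      by (simp add: power_mult_distrib power2_eq_square flip: powr_add)
    \<comment> \<open>The base is at least 1 and \<open>2 / p\<close> is below 1.\<close>
    also have "\<dots> \<le> (1 + \<bar>z\<bar> powr p) powr 1 * (norm x)\<^sup>2"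
      using p by (intro mult_right_mono powr_mono) auto
    finally show ?thesis by (simp add: add_nonneg_nonneg abs_of_nonneg)
  qed
  interpret flat_perturbation T S p
  proof (intro flat_perturbation.intro compact_contraction.intro contraction.intro
      compact_contraction_axioms.intro flat_perturbation_axioms.intro)
    \<comment> \<open>Contractivity is the case \<open>z = 0\<close>, where
      \<open>0 powr p = 0\<close>.\<close>
    show "norm (T x) \<le> norm x" for x
      using flat[of x 0] p by simp
  qed fact+
  obtain z where z: "z \<noteq> 0" and le: "\<And>x. norm (T x + z *\<^sub>R S x) \<le> norm x"
    using not_always_expanding by blast
  have "onorm (\<lambda>x. T x + z *\<^sub>R S x) \<le> 1"
    by (rule onorm_bound) (simp_all add: le)
  moreover have "1 < (1 + \<bar>z\<bar> powr p) powr (1 / p)"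
    using z p by (intro gr_one_powr) auto
  ultimately show False by (simp add: on)
qed

lemma scaleC_of_real: "of_real r *\<^sub>C x = r *\<^sub>R x"
  by transfer (simp add: scaleR_conv_of_real)

theorem theorem1p2:
  fixes p :: real and T S :: "ell2 \<Rightarrow> ell2"
  assumes "2 < p"
    and "T \<in> bounded_ops" and "S \<in> bounded_ops"
    and "\<forall>z1 z2 :: complex.
      onorm (\<lambda>x. z1 *\<^sub>C T x + z2 *\<^sub>C S x) = lp2_norm p (z1, z2)"
  shows "T \<in> bounded_ops - compact_ops \<and> S \<in> bounded_ops - compact_ops"
proof -
  have bl: "bounded_linear T" "bounded_linear S"
    using assms(2,3) by (auto simp: bounded_ops_def)
  have real: "onorm (\<lambda>x. a *\<^sub>R T x + b *\<^sub>R S x) = (\<bar>a\<bar> powr p + \<bar>b\<bar> powr p) powr (1 / p)" for a b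
    using assms(4)[rule_format, of "of_real a" "of_real b"]
    by (simp only: scaleC_of_real) (simp add: lp2_norm_def)
  have "\<not> compact (closure (T ` cball 0 1))"
    using real[of 1] by (intro onorm_powr_imp_not_compact[OF assms(1) bl]) simp
  \<comment> \<open>The norm identity is symmetric, so the roles swap: \<open>S\<close> has
    coefficient 1 and \<open>T\<close> is the perturbation.\<close>
  moreover have "\<not> compact (closure (S ` cball 0 1))"
    using real[of _ 1]
    by (intro onorm_powr_imp_not_compact[OF assms(1) bl(2) bl(1)]) (simp add: add.commute)
  ultimately show ?thesis
    using assms(2,3) by (simp add: compact_ops_def)
qed

end
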